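(* Let $3\le m\le n$ and let $c$ be an exact $(m+n+1)$-coloring of $[m]\times[n]$ such that $|c(D_m)|\le 3$. Then $[m]\times[n]$ contains a rainbow solution to $x_1+x_2=x_3$.
   Context: $[m]\times[n]=\{(i,j)\in\mathbb{Z}^2:1\le i\le m,1\le j\le n\}$ with componentwise addition. An $r$-coloring is a function $c:[m]\times[n]\to\{1,\dots,r\}$; exact means surjective. A rainbow solution to $x_1+x_2=x_3$ is a triple $\alpha,\beta,\gamma\in[m]\times[n]$ with $\alpha+\beta=\gamma$ and $c(\alpha),c(\beta),c(\gamma)$ pairwise distinct. For $k$ an integer, the $k$-th diagonal is $D_k=\{(i,j)\in[m]\times[n]: m-k=i-j\}$; $D_m=\{(i,i):1\le i\le m\}$ is the main diagonal. For $X\subseteq[m]\times[n]$, $c(X)=\{c(x):x\in X\}$. *)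

theory Defs
  imports Main "HOL-Library.Product_Plus"
begin

text \<open>Addition on \<open>int \<times> int\<close> is the componentwise addition of \<open>HOL-Library.Product_Plus\<close>.\<close>

definition grid :: "nat \<Rightarrow> nat \<Rightarrow> (int \<times> int) set" where
  "grid m n = {(i, j). 1 \<le> i \<and> i \<le> int m \<and> 1 \<le> j \<and> j \<le> int n}"

text \<open>Colorings are total functions on \<open>int \<times> int\<close>; their values outside the set \<open>X\<close> being
  colored are irrelevant.\<close>

definition coloring_on :: "(int \<times> int) set \<Rightarrow> nat \<Rightarrow> (int \<times> int \<Rightarrow> nat) \<Rightarrow> bool" where
  "coloring_on X r c \<longleftrightarrow> (\<forall>x\<in>X. c x \<in> {1..r})"

definition exact_coloring_on :: "(int \<times> int) set \<Rightarrow> nat \<Rightarrow> (int \<times> int \<Rightarrow> nat) \<Rightarrow> bool" where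
  "exact_coloring_on X r c \<longleftrightarrow> coloring_on X r c \<and> c ` X = {1..r}"

definition rainbow_solution ::
    "(int \<times> int) set \<Rightarrow> (int \<times> int \<Rightarrow> nat) \<Rightarrow> int \<times> int \<Rightarrow> int \<times> int \<Rightarrow> int \<times> int \<Rightarrow> bool" where
  "rainbow_solution X c \<alpha> \<beta> \<gamma> \<longleftrightarrow>
     \<alpha> \<in> X \<and> \<beta> \<in> X \<and> \<gamma> \<in> X \<and> \<alpha> + \<beta> = \<gamma> \<and>
     c \<alpha> \<noteq> c \<beta> \<and> c \<alpha> \<noteq> c \<gamma> \<and> c \<beta> \<noteq> c \<gamma>"

definition diagonal :: "nat \<Rightarrow> nat \<Rightarrow> int \<Rightarrow> (int \<times> int) set" where
  "diagonal m n k = {(i, j) \<in> grid m n. int m - k = i - j}"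

end

theory Submission
  imports Defs
begin

text \<open>Let \<open>K\<close> be the set of colors of the main diagonal and \<open>U\<close> the set of cells with a color
  outside \<open>K\<close>. If there is no rainbow solution, two cells of \<open>U\<close> on one diagonal have the same
  color, as they differ by a cell of the main diagonal. Counting then leaves only the tight case:
  \<open>card K = 3\<close>, every other diagonal meets \<open>U\<close>, and these diagonals get pairwise distinct new
  colors. Then cells \<open>x, y\<close> of \<open>U\<close> on distinct diagonals satisfy neither \<open>x + y \<in> grid\<close> nor
  (barring doubling of diagonals) \<open>x - y \<in> grid\<close>, so \<open>U\<close> is a thin staircase from \<open>(1, n)\<close> to
  \<open>(m, 1)\<close>, while cells \<open>z\<close> and \<open>x - z\<close> (or \<open>x + z\<close>) outside \<open>U\<close> have equal colors for \<open>x \<in> U\<close>.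
  Let \<open>(a + 1, a)\<close> and \<open>(b, b + 1)\<close> be the first cells of \<open>U\<close> next to the main diagonal and
  \<open>g = min a b\<close>. A horizontal and a vertical step of the staircase make the coloring constant on
  the square of side \<open>g - 1\<close>, and reflection transports this to the part of the main diagonal
  beyond \<open>g + 1\<close>. So \<open>K\<close> consists of the colors of \<open>1, g, g + 1\<close> on the main diagonal, which are
  not all distinct since \<open>1 + g = g + 1\<close>.\<close>

section \<open>Sums and differences of cells in a tight coloring\<close>

locale tight_coloring =
  fixes m n :: int and c :: "int \<Rightarrow> int \<Rightarrow> nat"
    and G :: "int \<Rightarrow> int \<Rightarrow> bool" and U :: "int \<Rightarrow> int \<Rightarrow> bool"
  assumes m2: "2 \<le> m" and n2: "2 \<le> n"
    and G_iff: "G i j \<longleftrightarrow> 1 \<le> i \<and> i \<le> m \<and> 1 \<le> j \<and> j \<le> n"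
    and U_iff: "U i j \<longleftrightarrow> G i j \<and> (\<forall>s. G s s \<longrightarrow> c s s \<noteq> c i j)"
    and rainbow_free: "G i j \<Longrightarrow> G i' j' \<Longrightarrow> G (i + i') (j + j') \<Longrightarrow>
      c i j = c i' j' \<or> c i j = c (i + i') (j + j') \<or> c i' j' = c (i + i') (j + j')"
    and U_color_iff: "U i j \<Longrightarrow> U i' j' \<Longrightarrow> c i j = c i' j' \<longleftrightarrow> i - j = i' - j'"
    and U_hits: "1 - n \<le> d \<Longrightarrow> d \<le> m - 1 \<Longrightarrow> d \<noteq> 0 \<Longrightarrow> \<exists>j. U (j + d) j"
begin

lemma U_G: "U i j \<Longrightarrow> G i j"
  using U_iff by blast

lemma not_U_diag: "\<not> U s s"
  using U_iff by blast

lemma U_color_neq: "U i j \<Longrightarrow> G i' j' \<Longrightarrow> \<not> U i' j' \<Longrightarrow> c i j \<noteq> c i' j'"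
  using U_iff by metis

text \<open>A cell outside \<open>U\<close> has a main-diagonal color, which no cell of
  \<open>U\<close> has. So of the three cells, the two outside \<open>U\<close> must agree.
  \<open>diff_color\<close> uses the same argument.\<close>

lemma sum_color:
  assumes "G i j" "\<not> U i j" "U i' j'" "G (i + i') (j + j')" "\<not> U (i + i') (j + j')"
  shows "c (i + i') (j + j') = c i j"
  using rainbow_free[OF assms(1) U_G[OF assms(3)] assms(4)]
    U_color_neq[OF assms(3,1,2)] U_color_neq[OF assms(3-5)] by auto

lemma diff_color:
  assumes "G i j" "\<not> U i j" "U i' j'" "G (i' - i) (j' - j)" "\<not> U (i' - i) (j' - j)"
  shows "c (i' - i) (j' - j) = c i j"
  using rainbow_free[OF assms(1,4)] U_G[OF assms(3)]
    U_color_neq[OF assms(3,1,2)] U_color_neq[OF assms(3-5)] by auto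

text \<open>Diagonal indices add, and both are nonzero, so the sum lies on a third diagonal; whether
  or not it is in \<open>U\<close>, its color differs from the other two.\<close>

lemma sum_not_G:
  assumes "U i j" "U i' j'" "i - j \<noteq> i' - j'"
  shows "\<not> G (i + i') (j + j')"
proof
  assume G: "G (i + i') (j + j')"
  have ne: "c i j \<noteq> c i' j'" using U_color_iff assms by blast
  have od: "i \<noteq> j" "i' \<noteq> j'" using assms not_U_diag by auto
  show False
  proof (cases "U (i + i') (j + j')")
    case True
    then show False
      using rainbow_free[OF U_G U_G G, OF assms(1,2)] ne od
        U_color_iff[OF assms(1) True] U_color_iff[OF assms(2) True] by auto
  next
    case False
    then show False
      using rainbow_free[OF U_G U_G G, OF assms(1,2)] ne
        U_color_neq[OF assms(1) G] U_color_neq[OF assms(2) G] by auto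
  qed
qed

text \<open>As for sums, except that the difference can share the diagonal, and so the color, of the
  subtrahend; this is the doubling excluded by the last hypothesis.\<close>

lemma diff_not_G:
  assumes "U i j" "U i' j'" "i - j \<noteq> i' - j'" "i - j \<noteq> 2 * (i' - j')"
  shows "\<not> G (i - i') (j - j')"
proof
  assume G: "G (i - i') (j - j')"
  have ne: "c i j \<noteq> c i' j'" using U_color_iff assms by blast
  have od: "i \<noteq> j" "i' \<noteq> j'" using assms not_U_diag by auto
  have rf: "c i' j' = c (i - i') (j - j') \<or> c i' j' = c i j \<or> c (i - i') (j - j') = c i j"
    using rainbow_free[OF U_G[OF assms(2)] G] U_G[OF assms(1)] by auto
  show False
  proof (cases "U (i - i') (j - j')")
    case True
    then show False
      using rf ne od assms(4)
        U_color_iff[OF assms(1) True] U_color_iff[OF assms(2) True] by auto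
  next
    case False
    then show False
      using rf ne U_color_neq[OF assms(1) G] U_color_neq[OF assms(2) G] by auto
  qed
qed

text \<open>Off the main diagonal, subtraction changes the diagonal. Two cells of \<open>U\<close>
  would then have distinct colors, both different from the color of the cell outside
  \<open>U\<close>.\<close>

lemma diff_not_U:
  assumes "G i j" "\<not> U i j" "i \<noteq> j" "U i' j'" "G (i' - i) (j' - j)"
  shows "\<not> U (i' - i) (j' - j)"
proof
  assume U: "U (i' - i) (j' - j)"
  have "c i' j' \<noteq> c (i' - i) (j' - j)"
    using U_color_iff[OF assms(4) U] assms(3) by simp
  then show False
    using rainbow_free[OF assms(1,5)] U_G[OF assms(4)]
      U_color_neq[OF assms(4,1,2)] U_color_neq[OF U assms(1,2)] by auto
qed

lemma first_U:
  assumes "1 - n \<le> d" "d \<le> m - 1" "d \<noteq> 0"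
  obtains q where "U (q + d) q" "\<And>q'. q' < q \<Longrightarrow> \<not> U (q' + d) q'"
proof -
  obtain q0 where q0: "U (q0 + d) q0" using U_hits[OF assms] by blast
  define k where "k = (LEAST k::nat. U (int k + d) (int k))"
  have "0 \<le> q0" using q0 U_G G_iff by force
  then have "U (int (nat q0) + d) (int (nat q0))" using q0 by simp
  then have k: "U (int k + d) (int k)" unfolding k_def by (rule LeastI)
  have "\<not> U (q' + d) q'" if "q' < int k" for q'
  proof
    assume u: "U (q' + d) q'"
    then have "0 \<le> q'" using U_G G_iff by force
    then have "k \<le> nat q'" unfolding k_def using u by (intro Least_le) simp
    then show False using that \<open>0 \<le> q'\<close> by linarith
  qed
  then show thesis using that k by blast
qed

text \<open>No order between \<open>m\<close> and \<open>n\<close> is fixed in the locale, so every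
  result can also be used with rows and columns exchanged.\<close>

lemma transposed: "tight_coloring n m (\<lambda>i j. c j i) (\<lambda>i j. G j i) (\<lambda>i j. U j i)"
proof
  show "2 \<le> n" "2 \<le> m" using m2 n2 by auto
  show "G j i = (1 \<le> i \<and> i \<le> n \<and> 1 \<le> j \<and> j \<le> m)" for i j using G_iff by auto
  show "U j i = (G j i \<and> (\<forall>s. G s s \<longrightarrow> c s s \<noteq> c j i))" for i j by (rule U_iff)
  show "c j i = c j' i' \<or> c j i = c (j + j') (i + i') \<or> c j' i' = c (j + j') (i + i')"
    if "G j i" "G j' i'" "G (j + j') (i + i')" for i j i' j'
    using rainbow_free that by blast
  show "c j i = c j' i' \<longleftrightarrow> i - j = i' - j'" if "U j i" "U j' i'" for i j i' j'
    using U_color_iff[OF that] by auto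
  show "\<exists>j. U j (j + d)" if "1 - m \<le> d" "d \<le> n - 1" "d \<noteq> 0" for d
  proof -
    have "\<exists>j. U (j + - d) j" using that by (intro U_hits) auto
    then obtain j where "U (j - d) j" by auto
    then have "U (j - d) ((j - d) + d)" by simp
    then show ?thesis by blast
  qed
qed

end

section \<open>The first cells of \<open>U\<close> next to the main diagonal\<close>

locale tight_coloring_near_diag = tight_coloring +
  fixes a b :: int
  assumes Ua: "U (a + 1) a" and Ub: "U b (b + 1)"
    and a_first: "\<And>q. U (q + 1) q \<Longrightarrow> a \<le> q" and b_first: "\<And>q. U q (q + 1) \<Longrightarrow> b \<le> q"
begin

lemma a_b_bounds: "1 \<le> a" "a + 1 \<le> m" "a \<le> n" "1 \<le> b" "b \<le> m" "b + 1 \<le> n"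
  using U_G[OF Ua] U_G[OF Ub] G_iff by auto

lemma near_diag_transposed:
  "tight_coloring_near_diag n m (\<lambda>i j. c j i) (\<lambda>i j. G j i) (\<lambda>i j. U j i) b a"
proof -
  interpret t: tight_coloring n m "\<lambda>i j. c j i" "\<lambda>i j. G j i" "\<lambda>i j. U j i"
    by (rule transposed)
  show ?thesis by unfold_locales (auto simp: Ua Ub a_first b_first)
qed

lemma min_le_sum: "min m n \<le> a + b"
  using sum_not_G[OF Ua Ub] G_iff a_b_bounds by auto

lemma a_le: "a \<le> b + 1"
  using diff_not_G[OF Ua Ub] G_iff a_b_bounds by auto

text \<open>Otherwise subtracting the cell from \<open>(a + 1, a)\<close> stays in the grid;
  doubling is ruled out because the index 1 is odd.\<close>

lemma not_U_below:
  assumes "1 \<le> j" "j \<le> i" "i < a"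
  shows "\<not> U i j"
proof
  assume U: "U i j"
  then have "i \<noteq> j" using not_U_diag by auto
  moreover have "i \<noteq> j + 1" using a_first[of j] U assms by auto
  moreover have "G (a + 1 - i) (a - j)" using assms a_b_bounds G_iff by auto
  ultimately show False using diff_not_G[OF Ua U] by auto
qed

text \<open>With \<open>j = s - a - 1\<close>, both diagonal cells have the color of
  \<open>(j, j + 1)\<close>: one is its sum with \<open>(a + 1, a)\<close>, the other its difference
  from \<open>(b, b + 1)\<close>.\<close>

lemma reflect:
  assumes "a + 2 \<le> s" "s \<le> min m n"
  shows "c s s = c (a + b + 1 - s) (a + b + 1 - s)"
proof -
  define j where "j = s - a - 1"
  have j: "1 \<le> j" "a + 1 + j \<le> m" "a + j + 1 \<le> n" "j < b"
    using assms min_le_sum by (auto simp: j_def)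
  have G: "G j (j + 1)" "G (j + (a + 1)) (j + 1 + a)" "G (b - j) (b + 1 - (j + 1))"
    using j a_b_bounds G_iff by auto
  have nU: "\<not> U j (j + 1)"
    using sum_not_G[OF _ Ua, of j "j + 1"] G(2) by auto
  have "c (j + (a + 1)) (j + 1 + a) = c j (j + 1)"
    using sum_color[OF G(1) nU Ua G(2)] not_U_diag[of "j + (a + 1)"]
    by (simp add: algebra_simps)
  moreover have "c (b - j) (b + 1 - (j + 1)) = c j (j + 1)"
    using diff_color[OF G(1) nU Ub G(3)] not_U_diag[of "b - j"] by simp
  ultimately show ?thesis by (simp add: j_def algebra_simps)
qed

text \<open>Rows of elements of \<open>U\<close> are monotone in the diagonal below the main one, so the column
  drops by at most one per diagonal; hence somewhere \<open>U\<close> steps horizontally out of column \<open>a\<close>.\<close>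
lemma horizontal_step:
  assumes "2 \<le> a"
  obtains P where "a < P" "U P a" "U P (a - 1)" "\<And>t. 0 < t \<Longrightarrow> \<not> U (P - t) (a - 1 - t)"
proof -
  have "\<forall>d. \<exists>q. 1 \<le> d \<and> d \<le> m - 1 \<longrightarrow> U (q + d) q \<and> (\<forall>q'<q. \<not> U (q' + d) q')"
  proof
    fix d
    show "\<exists>q. 1 \<le> d \<and> d \<le> m - 1 \<longrightarrow> U (q + d) q \<and> (\<forall>q'<q. \<not> U (q' + d) q')"
    proof (cases "1 \<le> d \<and> d \<le> m - 1")
      case True
      then have "1 - n \<le> d" "d \<le> m - 1" "d \<noteq> 0" using n2 by auto
      then show ?thesis by (rule first_U) blast
    qed blast
  qed
  then obtain q where q: "\<And>d. 1 \<le> d \<Longrightarrow> d \<le> m - 1 \<Longrightarrow> U (q d + d) (q d)"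
    and q_first: "\<And>d q'. 1 \<le> d \<Longrightarrow> d \<le> m - 1 \<Longrightarrow> q' < q d \<Longrightarrow> \<not> U (q' + d) q'"
    by metis
  have q1: "q 1 = a"
    using q[of 1] q_first[of 1 a] a_first[of "q 1"] Ua m2 by force
  \<comment> \<open>If the column dropped by two or more, the difference of the two first cells
    would lie in the grid.\<close>
  have step: "q d \<le> q (d + 1) + 1" if "1 \<le> d" "d + 1 \<le> m - 1" for d
  proof (rule ccontr)
    assume neg: "\<not> ?thesis"
    have U: "U (q d + d) (q d)" "U (q (d + 1) + (d + 1)) (q (d + 1))"
      using q[of d] q[of "d + 1"] that by auto
    have "\<not> G (q d + d - (q (d + 1) + (d + 1))) (q d - q (d + 1))"
      by (rule diff_not_G[OF U]) (use that in auto)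
    then show False using U_G[OF U(1)] U_G[OF U(2)] G_iff neg that by auto
  qed
  define k where "k = (LEAST k::nat. 1 \<le> k \<and> int k \<le> m - 1 \<and> q (int k) < a)"
  \<comment> \<open>This diagonal is the single corner \<open>(m, 1)\<close>, so the column does
    fall below \<open>a\<close>.\<close>
  have "q (m - 1) = 1" using U_G[OF q[of "m - 1"]] G_iff m2 by auto
  then have ex: "1 \<le> nat (m - 1) \<and> int (nat (m - 1)) \<le> m - 1 \<and> q (int (nat (m - 1))) < a"
    using assms m2 by auto
  have k: "1 \<le> k \<and> int k \<le> m - 1 \<and> q (int k) < a"
    unfolding k_def using ex by (rule LeastI)
  have k2: "2 \<le> k" using k q1 by (cases "k = 1") auto
  have "\<not> q (int (k - 1)) < a"
    using not_less_Least[of "k - 1" "\<lambda>k. 1 \<le> k \<and> int k \<le> m - 1 \<and> q (int k) < a"] k k2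
    unfolding k_def[symmetric] by auto
  moreover have "int (k - 1) = int k - 1" using k2 by auto
  ultimately have qa: "q (int k - 1) = a" "q (int k) = a - 1"
    using step[of "int k - 1"] k k2 by auto
  show thesis
  proof
    show "a < a - 1 + int k" using k2 by auto
    show "U (a - 1 + int k) a" using q[of "int k - 1"] qa k k2 by (simp add: algebra_simps)
    show "U (a - 1 + int k) (a - 1)" using q[of "int k"] qa k by simp
    show "\<not> U (a - 1 + int k - t) (a - 1 - t)" if "0 < t" for t
      using q_first[of "int k" "a - 1 - t"] qa k that by (simp add: algebra_simps)
  qed
qed

end

section \<open>Constancy of the coloring on the square\<close>

context tight_coloring_near_diag
begin

interpretation t: tight_coloring_near_diag n m "\<lambda>i j. c j i" "\<lambda>i j. G j i" "\<lambda>i j. U j i" b a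
  by (rule near_diag_transposed)

lemma not_U_square:
  assumes "1 \<le> i" "1 \<le> j" "i < min a b" "j < min a b"
  shows "\<not> U i j"
  using not_U_below[of j i] t.not_U_below[of i j] assms by (cases "j \<le> i") auto

text \<open>The two steps ends \<open>(P, a - 1)\<close> and \<open>(P, a)\<close> send
  \<open>(i, j)\<close> and \<open>(i, j + 1)\<close> to the same difference
  \<open>(P - i, a - 1 - j)\<close>.\<close>

lemma row_const:
  assumes "1 \<le> i" "1 \<le> j" "i < min a b" "j + 1 < min a b"
  shows "c i (j + 1) = c i j"
proof -
  have "2 \<le> a" using assms by auto
  then obtain P where P: "a < P" "U P a" "U P (a - 1)"
    "\<And>t. 0 < t \<Longrightarrow> \<not> U (P - t) (a - 1 - t)" by (rule horizontal_step) blast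
  have Pm: "P \<le> m" using U_G[OF P(2)] G_iff by auto
  have G: "G i j" "G i (j + 1)" "G (P - i) (a - 1 - j)"
    using assms P(1) Pm a_b_bounds G_iff by auto
  have nU: "\<not> U i j" "\<not> U i (j + 1)" using assms not_U_square by auto
  \<comment> \<open>For \<open>i = j\<close> the common cell precedes \<open>(P, a - 1)\<close> on
    its diagonal, where that cell is the first in \<open>U\<close>.\<close>
  have nU': "\<not> U (P - i) (a - 1 - j)"
  proof (cases "i = j")
    case True
    then show ?thesis using P(4)[of i] assms by auto
  next
    case False
    then show ?thesis using diff_not_U[OF G(1) nU(1) _ P(3) G(3)] by auto
  qed
  have "c (P - i) (a - 1 - j) = c i j"
    by (rule diff_color[OF G(1) nU(1) P(3) G(3) nU'])
  moreover have "c i (j + 1) = c (P - i) (a - 1 - j)"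
    using diff_color[OF G(3) nU' P(2)] G(2) nU(2) by (simp add: algebra_simps)
  ultimately show ?thesis by simp
qed

end

section \<open>Colors of the main diagonal\<close>

context tight_coloring_near_diag
begin

interpretation t: tight_coloring_near_diag n m "\<lambda>i j. c j i" "\<lambda>i j. G j i" "\<lambda>i j. U j i" b a
  by (rule near_diag_transposed)

lemma diag_const:
  assumes "1 \<le> s" "s < min a b"
  shows "c s s = c 1 1"
  using assms
proof (induction s rule: int_ge_induct)
  case (step s)
  have "c (s + 1) (s + 1) = c (s + 1) s" using step by (intro row_const) auto
  also have "\<dots> = c s s" using step by (intro t.row_const) auto
  finally show ?case using step by auto
qed simp

lemma diag_colors:
  assumes "G s s"
  shows "c s s \<in> {c 1 1, c (min a b) (min a b), c (min a b + 1) (min a b + 1)}"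
proof -
  define g where "g = min a b"
  have s: "1 \<le> s" "s \<le> min m n" using assms G_iff by auto
  have g: "1 \<le> g" "a \<le> g + 1" "b \<le> g + 1" "g = a \<or> g = b"
    using a_b_bounds a_le t.a_le by (auto simp: g_def)
  have small: "c r r \<in> {c 1 1, c g g}" if "1 \<le> r" "r \<le> g" for r
  proof (cases "r = g")
    case False
    then have "r < min a b" using that unfolding g_def by linarith
    then show ?thesis using diag_const[of r] that by simp
  qed simp
  consider "s \<le> g" | "s = g + 1" | "g + 2 \<le> s" by linarith
  then show ?thesis
  proof cases
    case 3
    \<comment> \<open>Reflection starts at \<open>g + 2\<close>, after transposing if
      \<open>g = b\<close>. As \<open>a\<close> and \<open>b\<close> differ by at most one, the
      image is at most \<open>g\<close>.\<close>
    then have "c s s = c (a + b + 1 - s) (a + b + 1 - s)"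
      using reflect[of s] t.reflect[of s] g(4) s by (auto simp: algebra_simps)
    moreover have "1 \<le> a + b + 1 - s" "a + b + 1 - s \<le> g"
      using min_le_sum s g 3 by auto
    ultimately show ?thesis using small[of "a + b + 1 - s"] by (auto simp: g_def)
  qed (use small[of s] s in \<open>auto simp: g_def\<close>)
qed

lemma card_diag_colors: "card {c s s |s. G s s} \<le> 2"
proof -
  define g where "g = min a b"
  have G: "G 1 1" "G g g" "G (1 + g) (1 + g)"
    using a_b_bounds m2 n2 G_iff by (auto simp: g_def)
  have "card {c 1 1, c g g, c (1 + g) (1 + g)} \<le> 2"
    using rainbow_free[OF G] by (auto simp: card_insert_if)
  moreover have "{c s s |s. G s s} \<subseteq> {c 1 1, c g g, c (1 + g) (1 + g)}"
    using diag_colors by (fastforce simp: g_def add.commute)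
  ultimately show ?thesis by (meson card_mono finite.emptyI finite.insertI le_trans)
qed

end

lemma (in tight_coloring) card_diag_colors_le_2: "card {c s s |s. G s s} \<le> 2"
proof -
  interpret t: tight_coloring n m "\<lambda>i j. c j i" "\<lambda>i j. G j i" "\<lambda>i j. U j i"
    by (rule transposed)
  obtain a where a: "U (a + 1) a" "\<And>q. q < a \<Longrightarrow> \<not> U (q + 1) q"
    using first_U[of 1] m2 n2 by auto
  obtain b where b: "U b (b + 1)" "\<And>q. q < b \<Longrightarrow> \<not> U q (q + 1)"
    using t.first_U[of 1] m2 n2 by auto
  interpret tight_coloring_near_diag m n c G U a b
    by unfold_locales (use a b in \<open>auto intro: leI\<close>)
  show ?thesis by (rule card_diag_colors)
qed

section \<open>Reduction to the tight case by counting\<close>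

theorem theorem3p4:
  fixes m n :: nat and c :: "int \<times> int \<Rightarrow> nat"
  assumes "3 \<le> m" and "m \<le> n"
    and "exact_coloring_on (grid m n) (m + n + 1) c"
    and "card (c ` diagonal m n (int m)) \<le> 3"
  shows "\<exists>\<alpha> \<beta> \<gamma>. rainbow_solution (grid m n) c \<alpha> \<beta> \<gamma>"
proof (rule ccontr)
  assume no_rainbow: "\<not> ?thesis"
  define G where "G i j \<longleftrightarrow> (i, j) \<in> grid m n" for i j
  define K where "K = c ` diagonal m n (int m)"
  define U where "U i j \<longleftrightarrow> G i j \<and> c (i, j) \<notin> K" for i j
  have G_iff: "G i j \<longleftrightarrow> 1 \<le> i \<and> i \<le> int m \<and> 1 \<le> j \<and> j \<le> int n" for i j
    by (auto simp: G_def grid_def)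
  have K: "K = {c (s, s) |s. G s s}"
    by (auto simp: K_def diagonal_def G_def)
  have rf: "c (i, j) = c (i', j') \<or> c (i, j) = c (i + i', j + j') \<or> c (i', j') = c (i + i', j + j')"
    if "G i j" "G i' j'" "G (i + i') (j + j')" for i j i' j'
    using no_rainbow that unfolding rainbow_solution_def G_def by (metis add_Pair)
  have same_lt: "c (i, j) = c (i', j')" if "U i j" "U i' j'" "i - j = i' - j'" "i < i'" for i j i' j'
  proof -
    have G: "G (i' - i) (i' - i)" using that by (auto simp: U_def G_iff)
    have "i + (i' - i) = i'" "j + (i' - i) = j'" using that by auto
    then have "c (i, j) = c (i' - i, i' - i) \<or> c (i, j) = c (i', j') \<or> c (i' - i, i' - i) = c (i', j')"
      using rf[OF _ G, of i j] that(1,2) unfolding U_def by simp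
    moreover have "c (i' - i, i' - i) \<in> K" using G K by blast
    ultimately show ?thesis using that(1,2) unfolding U_def by metis
  qed
  have same: "c (i, j) = c (i', j')" if "U i j" "U i' j'" "i - j = i' - j'" for i j i' j'
    using same_lt[of i j i' j'] same_lt[of i' j' i j] that
    by (cases i i' rule: linorder_cases) auto
  \<comment> \<open>\<open>D\<close> holds the indices of all diagonals but the main one,
    \<open>E\<close> those met by \<open>U\<close>, and \<open>\<phi>\<close> gives the one new
    color on each.\<close>
  define D where "D = {1 - int n..int m - 1} - {0}"
  define E where "E = {i - j |i j. U i j}"
  define \<phi> where "\<phi> d = (SOME p. \<exists>i j. U i j \<and> i - j = d \<and> c (i, j) = p)" for d
  have \<phi>: "\<phi> (i - j) = c (i, j)" if "U i j" for i j
  proof -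
    have "\<exists>i' j'. U i' j' \<and> i' - j' = i - j \<and> c (i', j') = \<phi> (i - j)"
      unfolding \<phi>_def by (rule someI_ex) (use that in blast)
    then show ?thesis using same that by metis
  qed
  have finD: "finite D" and cardD: "card D = m + n - 2"
    using assms(1,2) by (auto simp: D_def)
  have "i \<noteq> j" if "U i j" for i j
    using that K unfolding U_def by blast
  then have ED: "E \<subseteq> D"
    by (fastforce simp: E_def D_def U_def G_iff)
  then have finE: "finite E" using finD finite_subset by blast
  have img: "\<phi> ` E = {1..m + n + 1} - K"
  proof -
    have "c ` grid m n = {1..m + n + 1}"
      using assms(3) by (auto simp: exact_coloring_on_def)
    moreover have "\<phi> ` E = c ` grid m n - K"
    proof (rule set_eqI)
      fix p
      have "p \<in> \<phi> ` E \<longleftrightarrow> (\<exists>i j. U i j \<and> p = c (i, j))"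
        unfolding E_def using \<phi> by (auto simp: image_iff) metis+
      also have "\<dots> \<longleftrightarrow> p \<in> c ` grid m n - K" by (auto simp: U_def G_def)
      finally show "p \<in> \<phi> ` E \<longleftrightarrow> p \<in> c ` grid m n - K" .
    qed
    ultimately show ?thesis by simp
  qed
  have "finite K"
  proof -
    have "grid m n \<subseteq> {1..int m} \<times> {1..int n}" by (auto simp: grid_def)
    then have "finite (diagonal m n (int m))"
      by (rule finite_subset[rotated, OF finite_subset]) (auto simp: diagonal_def)
    then show ?thesis by (simp add: K_def)
  qed
  then have "m + n + 1 - card K \<le> card (\<phi> ` E)"
    using diff_card_le_card_Diff[of K "{1..m + n + 1}"] img by simp
  moreover have "card (\<phi> ` E) \<le> card E" "card E \<le> card D"
    using card_image_le[OF finE] card_mono[OF finD ED] by auto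
  moreover have "card K \<le> 3" using assms(4) by (simp add: K_def)
  \<comment> \<open>Since \<open>m + n + 1 - 3 = m + n - 2 = card D\<close>, all these inequalities
    are equalities.\<close>
  ultimately have tight: "card K = 3" "card (\<phi> ` E) = card E" "card E = card D"
    using cardD assms(1) by auto
  have inj: "inj_on \<phi> E" using eq_card_imp_inj_on[OF finE tight(2)] .
  have "E = D" using card_subset_eq[OF finD ED tight(3)] .
  interpret tight_coloring "int m" "int n" "\<lambda>i j. c (i, j)" G U
  proof
    show "2 \<le> int m" "2 \<le> int n" using assms(1,2) by auto
    show "U i j \<longleftrightarrow> G i j \<and> (\<forall>s. G s s \<longrightarrow> c (s, s) \<noteq> c (i, j))" for i j
      unfolding U_def K by auto
    show "c (i, j) = c (i', j') \<longleftrightarrow> i - j = i' - j'" if "U i j" "U i' j'" for i j i' j'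
    proof -
      have "i - j \<in> E" "i' - j' \<in> E" using that by (auto simp: E_def)
      then show ?thesis using inj_on_eq_iff[OF inj] \<phi> that by metis
    qed
    show "\<exists>j. U (j + d) j" if "1 - int n \<le> d" "d \<le> int m - 1" "d \<noteq> 0" for d
    proof -
      have "d \<in> E" using \<open>E = D\<close> that by (auto simp: D_def)
      then obtain i j where "U i j" "d = i - j" by (auto simp: E_def)
      then have "U (j + d) j" by simp
      then show ?thesis by blast
    qed
  qed (use G_iff rf in auto)
  show False using card_diag_colors_le_2 tight(1) K by simp
qed

end
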